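(* Let $M$ be a Riemannian manifold, let $\eta:M\times M\to TM$ satisfy $\eta(u,v)\in T_vM$ for all $u,v\in M$, and let $m$ and $k$ be positive integers. Let $h_1,\dots,h_k:M\to\mathbb{R}$ be differentiable strongly $\eta$-invex functions of order $m$ on $M$. Then $u^*\in M$ is a solution of the vector variational-like inequality problem (VVLIP) associated with the gradients of $h_1,\dots,h_k$ if and only if $u^*$ is a strict $\eta$-minimizer of order $m$ for the multi-objective optimization problem (MOP) of minimizing $(h_1(u),\dots,h_k(u))$ over $u\in M$.
   Context: Manifolds are $C^\infty$, modelled on a Hilbert space (finite or infinite dimensional), with Riemannian metric $\langle\cdot,\cdot\rangle_p$ and norm $\|\cdot\|_p$ on $T_pM$; $\nabla h_i$ denotes the gradient of $h_i$. Vector order: for $a,b\in\mathbb{R}^k$, $a<b$ means $a_i<b_i$ for every $i=1,\dots,k$, and $a\nless b$ is its negation. When a real number is added to a vector of $\mathbb{R}^k$ it is added to every component. Strongly $\eta$-invex of order $m$ (for differentiable $h:M\to\mathbb{R}$): there exists $\delta>0$ such that for all $u,v\in M$, $$h(u)\ge h(v)+dh_v(\eta(u,v))+\delta\|\eta(u,v)\|_v^m .$$ VVLIP: find $u^*\in M$ such that, with $X_i=\nabla h_i(u^* )$, $1\le i\le k$, $$\big(\langle X_1,\eta(u,u^* )\rangle_{u^*},\dots,\langle X_k,\eta(u,u^* )\rangle_{u^*}\big)\nless 0\quad\text{for all }u\in M.$$ Strict $\eta$-minimizer of order $m$ for MOP: a point $u^*\in M$ for which there exists $\delta>0$ such that,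 with $h=(h_1,\dots,h_k)$, $$h(u)\nless h(u^* )+\delta\|\eta(u,u^* )\|_{u^*}^m\quad\text{for all }u\in M.$$ *)

theory Defs
  imports "HOL-Analysis.Analysis"
begin

text \<open>
  The Hilbert space on which a manifold is modelled is a type
  of sort \<open>{real_inner, complete_space}\<close>; no bound on the dimension is imposed.
\<close>

section \<open>Smooth maps between normed spaces\<close>

text \<open>A continuous \<open>n\<close>-linear map takes its arguments as a list of length \<open>n\<close>;
  its values on lists of other lengths are irrelevant.\<close>

definition bounded_multilinear ::
    "nat \<Rightarrow> ('e::real_normed_vector list \<Rightarrow> 'f::real_normed_vector) \<Rightarrow> bool" where
  "bounded_multilinear n T \<longleftrightarrow>
     (\<forall>us ws. length us + 1 + length ws = n \<longrightarrow> linear (\<lambda>v. T (us @ v # ws))) \<and>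
     (\<exists>K. \<forall>vs. length vs = n \<longrightarrow> norm (T vs) \<le> K * prod_list (map norm vs))"

text \<open>
  Being \<open>C\<^sup>\<infinity>\<close> in the Frechet sense. The successive derivatives take values in the spaces
  \<open>L(E,F)\<close>, \<open>L(E,L(E,F))\<close>, ..., which have different types; they are therefore represented
  through the isometric spaces of continuous \<open>n\<close>-linear maps, \<open>D n x\<close> being the \<open>n\<close>-th derivative
  at \<open>x\<close>. The last clause says that \<open>D (Suc n) x\<close> is the Frechet derivative
  of \<open>D n\<close> at \<open>x\<close> with respect to the operator norm. The set \<open>S\<close> is meant to be open.
\<close>

definition smooth_on ::
    "'e::real_normed_vector set \<Rightarrow> ('e \<Rightarrow> 'f::real_normed_vector) \<Rightarrow> bool" where
  "smooth_on S f \<longleftrightarrow>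
     (\<exists>D :: nat \<Rightarrow> 'e \<Rightarrow> 'e list \<Rightarrow> 'f.
        (\<forall>x\<in>S. D 0 x [] = f x) \<and>
        (\<forall>n. \<forall>x\<in>S. bounded_multilinear n (D n x)) \<and>
        (\<forall>n. \<forall>x\<in>S. \<forall>\<epsilon>>0. \<exists>\<delta>>0. \<forall>y\<in>S. norm (y - x) < \<delta> \<longrightarrow>
           (\<forall>vs. length vs = n \<longrightarrow>
              norm (D n y vs - D n x vs - D (Suc n) x ((y - x) # vs))
                \<le> \<epsilon> * norm (y - x) * prod_list (map norm vs))))"

section \<open>Smooth manifolds modelled on a Hilbert space\<close>

text \<open>A chart \<open>(U, \<phi>)\<close>; the values of \<open>\<phi>\<close> outside \<open>U\<close> are irrelevant.\<close>

type_synonym ('a, 'e) chart = "'a set \<times> ('a \<Rightarrow> 'e)"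

definition is_chart ::
    "'a topology \<Rightarrow> ('a, 'e::{real_inner, complete_space}) chart \<Rightarrow> bool" where
  "is_chart X c \<longleftrightarrow>
     openin X (fst c) \<and> open (snd c ` fst c) \<and>
     homeomorphic_map (subtopology X (fst c)) (top_of_set (snd c ` fst c)) (snd c)"

definition chart_inv :: "('a, 'e) chart \<Rightarrow> 'e \<Rightarrow> 'a" where
  "chart_inv c = inv_into (fst c) (snd c)"

definition transition :: "('a, 'e) chart \<Rightarrow> ('a, 'e) chart \<Rightarrow> 'e \<Rightarrow> 'e" where
  "transition c c' = snd c' \<circ> chart_inv c"

definition smooth_atlas ::
    "'a topology \<Rightarrow> ('a, 'e::{real_inner, complete_space}) chart set \<Rightarrow> bool" where
  "smooth_atlas X A \<longleftrightarrow>
     (\<forall>c\<in>A. is_chart X c) \<and>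
     (\<Union>c\<in>A. fst c) = topspace X \<and>
     (\<forall>c\<in>A. \<forall>c'\<in>A. smooth_on (snd c ` (fst c \<inter> fst c')) (transition c c'))"

text \<open>The smooth structure is the one generated by \<open>A\<close>, which need not be maximal. Second
  countability is not required: it would exclude non-separable model spaces.\<close>

definition smooth_manifold ::
    "'a topology \<Rightarrow> ('a, 'e::{real_inner, complete_space}) chart set \<Rightarrow> bool" where
  "smooth_manifold X A \<longleftrightarrow> Hausdorff_space X \<and> smooth_atlas X A"

section \<open>Tangent spaces, differentials\<close>

definition charts_at :: "('a, 'e) chart set \<Rightarrow> 'a \<Rightarrow> ('a, 'e) chart set" where
  "charts_at A p = {c \<in> A. p \<in> fst c}"

text \<open>
  A tangent vector at \<open>p\<close> is an equivalence class of pairs \<open>(c, w)\<close>, where \<open>c\<close> is a chart at \<open>p\<close> and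
  \<open>w\<close> is a vector of the model space, under
  \<open>(c, w) \<sim> (c', w')\<close> iff \<open>w' = D(\<phi>' \<circ> \<phi>\<^sup>-\<^sup>1)(\<phi> p) w\<close>. Such a class contains exactly one pair for each
  chart at \<open>p\<close>, so it is the graph of a function on the charts at \<open>p\<close>. This function, extended by
  zero to all other pairs, represents the tangent vector; the vector space operations are pointwise.
\<close>

type_synonym ('a, 'e) tvec = "('a, 'e) chart \<Rightarrow> 'e"

definition tangent_space ::
    "('a, 'e::{real_inner, complete_space}) chart set \<Rightarrow> 'a \<Rightarrow> ('a, 'e) tvec set" where
  "tangent_space A p =
     {v. (\<forall>c. c \<notin> charts_at A p \<longrightarrow> v c = 0) \<and>
         (\<forall>c\<in>charts_at A p. \<forall>c'\<in>charts_at A p.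
            v c' = frechet_derivative (transition c c') (at (snd c p)) (v c))}"

definition differentiable_fun ::
    "('a, 'e::{real_inner, complete_space}) chart set \<Rightarrow> ('a \<Rightarrow> real) \<Rightarrow> bool" where
  "differentiable_fun A h \<longleftrightarrow>
     (\<forall>c\<in>A. \<forall>p\<in>fst c. (h \<circ> chart_inv c) differentiable (at (snd c p)))"

text \<open>By the chain rule, the value does not depend on the chart that is chosen.\<close>

definition differential ::
    "('a, 'e::{real_inner, complete_space}) chart set \<Rightarrow> ('a \<Rightarrow> real) \<Rightarrow> 'a
      \<Rightarrow> ('a, 'e) tvec \<Rightarrow> real" where
  "differential A h p v =
     (let c = (SOME c. c \<in> charts_at A p)
      in frechet_derivative (h \<circ> chart_inv c) (at (snd c p)) (v c))"

section \<open>Riemannian metrics, gradients\<close>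

text \<open>
  \<open>g p\<close> is an inner product on the tangent space at \<open>p\<close> that induces its Hilbert space topology and
  depends smoothly on \<open>p\<close>. In a chart, it is a continuous bilinear form
  \<open>G x\<close> on the model space, smooth in \<open>x\<close> for the operator norm; this includes the bilinearity and
  continuity of \<open>g p\<close>. The lower bound by \<open>C\<close> gives positive definiteness and, with continuity, says
  that the norm of \<open>g p\<close> is equivalent to the norm of the model space.
\<close>

definition riemannian_metric ::
    "('a, 'e::{real_inner, complete_space}) chart set
      \<Rightarrow> ('a \<Rightarrow> ('a, 'e) tvec \<Rightarrow> ('a, 'e) tvec \<Rightarrow> real) \<Rightarrow> bool" where
  "riemannian_metric A g \<longleftrightarrow>
     (\<forall>c\<in>A. \<exists>G :: 'e \<Rightarrow> 'e \<Rightarrow>\<^sub>L 'e \<Rightarrow>\<^sub>L real.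
        smooth_on (snd c ` fst c) G \<and>
        (\<forall>p\<in>fst c. \<forall>v\<in>tangent_space A p. \<forall>w\<in>tangent_space A p.
           g p v w = blinfun_apply (blinfun_apply (G (snd c p)) (v c)) (w c))) \<and>
     (\<forall>c\<in>A. \<forall>p\<in>fst c. \<forall>v\<in>tangent_space A p. \<forall>w\<in>tangent_space A p. g p v w = g p w v) \<and>
     (\<forall>c\<in>A. \<forall>p\<in>fst c. \<exists>C>0. \<forall>v\<in>tangent_space A p. C * (norm (v c))\<^sup>2 \<le> g p v v)"

definition riemannian_manifold ::
    "'a topology \<Rightarrow> ('a, 'e::{real_inner, complete_space}) chart set
      \<Rightarrow> ('a \<Rightarrow> ('a, 'e) tvec \<Rightarrow> ('a, 'e) tvec \<Rightarrow> real) \<Rightarrow> bool" where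
  "riemannian_manifold X A g \<longleftrightarrow> smooth_manifold X A \<and> riemannian_metric A g"

definition metric_norm ::
    "('a \<Rightarrow> ('a, 'e) tvec \<Rightarrow> ('a, 'e) tvec \<Rightarrow> real) \<Rightarrow> 'a \<Rightarrow> ('a, 'e) tvec \<Rightarrow> real" where
  "metric_norm g p v = sqrt (g p v v)"

definition gradient ::
    "('a, 'e::{real_inner, complete_space}) chart set
      \<Rightarrow> ('a \<Rightarrow> ('a, 'e) tvec \<Rightarrow> ('a, 'e) tvec \<Rightarrow> real)
      \<Rightarrow> ('a \<Rightarrow> real) \<Rightarrow> 'a \<Rightarrow> ('a, 'e) tvec" where
  "gradient A g h p =
     (THE Y. Y \<in> tangent_space A p \<and>
        (\<forall>v\<in>tangent_space A p. g p Y v = differential A h p v))"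

section \<open>Invexity, variational-like inequalities and optimization\<close>

text \<open>Vectors of \<open>\<real>\<^sup>k\<close> are functions on the indices \<open>1, \<dots>, k\<close>. The relation \<open><\<close> on the library's type
  of real vectors is not used because it is not the componentwise strict order.\<close>

definition vec_less :: "nat \<Rightarrow> (nat \<Rightarrow> real) \<Rightarrow> (nat \<Rightarrow> real) \<Rightarrow> bool" where
  "vec_less k a b \<longleftrightarrow> (\<forall>i\<in>{1..k}. a i < b i)"

definition strongly_invex ::
    "'a topology \<Rightarrow> ('a, 'e::{real_inner, complete_space}) chart set
      \<Rightarrow> ('a \<Rightarrow> ('a, 'e) tvec \<Rightarrow> ('a, 'e) tvec \<Rightarrow> real)
      \<Rightarrow> ('a \<Rightarrow> 'a \<Rightarrow> ('a, 'e) tvec) \<Rightarrow> nat \<Rightarrow> ('a \<Rightarrow> real) \<Rightarrow> bool" where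
  "strongly_invex X A g \<eta> m h \<longleftrightarrow>
     (\<exists>\<delta>>0. \<forall>u\<in>topspace X. \<forall>v\<in>topspace X.
        h u \<ge> h v + differential A h v (\<eta> u v) + \<delta> * metric_norm g v (\<eta> u v) ^ m)"

definition VVLIP_solution ::
    "'a topology \<Rightarrow> ('a, 'e::{real_inner, complete_space}) chart set
      \<Rightarrow> ('a \<Rightarrow> ('a, 'e) tvec \<Rightarrow> ('a, 'e) tvec \<Rightarrow> real)
      \<Rightarrow> ('a \<Rightarrow> 'a \<Rightarrow> ('a, 'e) tvec) \<Rightarrow> nat \<Rightarrow> (nat \<Rightarrow> 'a \<Rightarrow> real) \<Rightarrow> 'a \<Rightarrow> bool" where
  "VVLIP_solution X A g \<eta> k h u' \<longleftrightarrow>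
     u' \<in> topspace X \<and>
     (\<forall>u\<in>topspace X.
        \<not> vec_less k (\<lambda>i. g u' (gradient A g (h i) u') (\<eta> u u')) (\<lambda>i. 0))"

definition strict_minimizer ::
    "'a topology
      \<Rightarrow> ('a \<Rightarrow> ('a, 'e::{real_inner, complete_space}) tvec \<Rightarrow> ('a, 'e) tvec \<Rightarrow> real)
      \<Rightarrow> ('a \<Rightarrow> 'a \<Rightarrow> ('a, 'e) tvec) \<Rightarrow> nat \<Rightarrow> nat \<Rightarrow> (nat \<Rightarrow> 'a \<Rightarrow> real) \<Rightarrow> 'a \<Rightarrow> bool" where
  "strict_minimizer X g \<eta> m k h u' \<longleftrightarrow>
     u' \<in> topspace X \<and>
     (\<exists>\<delta>>0. \<forall>u\<in>topspace X.
        \<not> vec_less k (\<lambda>i. h i u) (\<lambda>i. h i u' + \<delta> * metric_norm g u' (\<eta> u u') ^ m))"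

end

theory Submission
  imports Defs
begin

text \<open>
  Let \<open>u'\<close> be a point. If the inequality problem is solved at \<open>u'\<close>, the least of the invexity
  constants of \<open>h\<^sub>1, \<dots>, h\<^sub>k\<close> serves as the constant of strict minimality. Conversely, a strict
  minimizer is in particular a weak Pareto minimizer; if all \<open>h\<^sub>i\<close> had negative derivative in one
  direction \<open>\<eta> u u'\<close>, then a short step in this direction, taken in a chart, would decrease all of
  them at once. This half does not involve \<open>\<eta>\<close> at the point reached, because \<open>\<delta> * norm ^ m \<ge> 0\<close>.

  What requires work is that \<open>gradient\<close>, a definite description, exists: this is the Riesz
  representation theorem on the tangent space, which a chart identifies with the model space.
\<close>

section \<open>Representation of functionals by a coercive form\<close>

text \<open>Half the quadratic vanishes at \<open>t = 0\<close>, so nonnegativity makes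
  \<open>0\<close> a minimum, where the derivative \<open>s\<close> must be zero.\<close>

lemma quadratic_nonneg_imp_linear_coeff_zero:
  fixes s q :: real
  assumes "\<And>t. 2 * t * s + t\<^sup>2 * q \<ge> 0"
  shows "s = 0"
proof (rule DERIV_local_min)
  show "((\<lambda>t. t * s + t\<^sup>2 * q / 2) has_real_derivative s) (at 0)"
    by (auto intro!: derivative_eq_intros)
  show "\<forall>t. \<bar>0 - t\<bar> < 1 \<longrightarrow> 0 * s + 0\<^sup>2 * q / 2 \<le> t * s + t\<^sup>2 * q / 2"
  proof (intro allI impI)
    fix t show "0 * s + 0\<^sup>2 * q / 2 \<le> t * s + t\<^sup>2 * q / 2"
      using assms[of t] by simp
  qed
qed simp

text \<open>Riesz representation by the direct method: the energy \<open>b x x - 2 * f x\<close> is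
  bounded below, its minimizing sequences are Cauchy, and the vanishing first variation at the limit
  is the required equation. Coercivity transfers the completeness of the given norm to the form
  \<open>b\<close>.\<close>

lemma coercive_representation:
  fixes b :: "'e::{real_normed_vector, complete_space} \<Rightarrow> 'e \<Rightarrow> real"
  assumes b: "bounded_bilinear b" and sym: "\<And>x y. b x y = b y x"
    and C: "C > 0" and coercive: "\<And>x. C * (norm x)\<^sup>2 \<le> b x x"
    and f: "bounded_linear f"
  shows "\<exists>!y. \<forall>w. b y w = f w"
proof (rule ex_ex1I)
  interpret b: bounded_bilinear b by fact
  interpret f: bounded_linear f by fact
  define J where "J x = b x x - 2 * f x" for x
  obtain K where K: "\<And>x. \<bar>f x\<bar> \<le> norm x * K"
    using f.bounded by auto
  have J_ge: "J x \<ge> - (K\<^sup>2 / C)" for x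
  proof -
    \<comment> \<open>Completing the square bounds the energy below by the minimum of
      \<open>C * r\<^sup>2 - 2 * K * r\<close> over real \<open>r\<close>.\<close>
    have "0 \<le> (C * norm x - K)\<^sup>2 / C" using C by simp
    also have "\<dots> = C * (norm x)\<^sup>2 - 2 * (norm x * K) + K\<^sup>2 / C"
      using C by (simp add: power2_eq_square field_simps)
    finally show ?thesis using coercive[of x] K[of x] by (simp add: J_def)
  qed
  define d where "d = Inf (range J)"
  have bdd: "bdd_below (range J)" using J_ge by (auto simp: bdd_below_def)
  have d_le: "d \<le> J x" for x
    unfolding d_def by (rule cInf_lower[OF _ bdd]) simp
  have "\<exists>x. J x < d + inverse (real (Suc n))" for n
  proof -
    have "Inf (range J) < d + inverse (real (Suc n))" by (simp add: d_def)
    then show ?thesis by (subst (asm) cInf_less_iff[OF _ bdd]) auto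
  qed
  then obtain x where x: "\<And>n. J (x n) < d + inverse (real (Suc n))" by metis
  \<comment> \<open>The linear terms cancel in the parallelogram law, and the energy of the midpoint
    is at least \<open>d\<close>. Hence two points of almost minimal energy are close to each
    other.\<close>
  have parallelogram: "C * (norm (v - w))\<^sup>2 \<le> 2 * (J v - d) + 2 * (J w - d)" for v w
  proof -
    have "b (v - w) (v - w) = 2 * J v + 2 * J w - 4 * J ((1/2) *\<^sub>R (v + w))"
      by (simp add: J_def b.diff_left b.diff_right b.add_left b.add_right b.scaleR_left
          b.scaleR_right f.scaleR f.add sym[of w v] algebra_simps)
    then show ?thesis using coercive[of "v - w"] d_le[of "(1/2) *\<^sub>R (v + w)"] by simp
  qed
  have "Cauchy x"
  proof (rule metric_CauchyI)
    fix e :: real assume "e > 0"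
    \<comment> \<open>The two excesses over \<open>d\<close> enter with factor 2 each, so a quarter
      of \<open>C * e\<^sup>2\<close> for each suffices.\<close>
    then have "C * e\<^sup>2 / 4 > 0" using C by simp
    then obtain N where N: "inverse (real (Suc N)) < C * e\<^sup>2 / 4"
      using reals_Archimedean by blast
    have small: "J (x n) - d < C * e\<^sup>2 / 4" if "n \<ge> N" for n
    proof -
      have "inverse (real (Suc n)) \<le> inverse (real (Suc N))" using that by simp
      then show ?thesis using x[of n] N by linarith
    qed
    show "\<exists>M. \<forall>m\<ge>M. \<forall>n\<ge>M. dist (x m) (x n) < e"
    proof (intro exI allI impI)
      fix m n assume "m \<ge> N" "n \<ge> N"
      from small[OF this(1)] small[OF this(2)] have "C * (norm (x m - x n))\<^sup>2 < C * e\<^sup>2"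
        using parallelogram[of "x m" "x n"] by simp
      then have "(norm (x m - x n))\<^sup>2 < e\<^sup>2" using C by simp
      then show "dist (x m) (x n) < e"
        using \<open>e > 0\<close> by (simp add: dist_norm power2_less_imp_less)
    qed
  qed
  then obtain y where y: "x \<longlonglongrightarrow> y"
    using Cauchy_convergent convergent_def by blast
  have "(\<lambda>n. J (x n)) \<longlonglongrightarrow> J y"
    unfolding J_def by (intro tendsto_intros b.tendsto f.tendsto y)
  moreover have "(\<lambda>n. d + inverse (real (Suc n))) \<longlonglongrightarrow> d"
    using tendsto_add[OF tendsto_const[of d] LIMSEQ_inverse_real_of_nat] by simp
  ultimately have "J y \<le> d"
    by (rule LIMSEQ_le) (use x less_imp_le in blast)
  have "b y w = f w" for w
  proof -
    \<comment> \<open>This is the change of the energy from the minimizer \<open>y\<close> to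
      \<open>y + t *\<^sub>R w\<close>.\<close>
    have "2 * t * (b y w - f w) + t\<^sup>2 * b w w \<ge> 0" for t
    proof -
      have "J (y + t *\<^sub>R w) = J y + (2 * t * (b y w - f w) + t\<^sup>2 * b w w)"
        by (simp add: J_def b.add_left b.add_right b.scaleR_left b.scaleR_right f.scaleR f.add
            sym[of w y] power2_eq_square algebra_simps)
      then show ?thesis using d_le[of "y + t *\<^sub>R w"] \<open>J y \<le> d\<close> by linarith
    qed
    then show ?thesis
      using quadratic_nonneg_imp_linear_coeff_zero[of "b y w - f w" "b w w"] by simp
  qed
  then show "\<exists>y. \<forall>w. b y w = f w" by blast
next
  interpret b: bounded_bilinear b by fact
  fix y z assume "\<forall>w. b y w = f w" "\<forall>w. b z w = f w"
  then have "b (y - z) (y - z) = 0" by (simp add: b.diff_left)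
  then have "C * (norm (y - z))\<^sup>2 \<le> 0" using coercive[of "y - z"] by simp
  then show "y = z" using C by (simp add: mult_le_0_iff)
qed

section \<open>Charts and tangent vectors\<close>

text \<open>The case \<open>n = 0\<close> of the derivative clause: the only argument list is empty
  with norm product 1, and \<open>D 1 x\<close> on one-element lists is the derivative. It is
  obtained within \<open>S\<close> first; openness of \<open>S\<close> removes the
  restriction.\<close>

lemma smooth_on_imp_differentiable:
  fixes f :: "'e::real_normed_vector \<Rightarrow> 'f::real_normed_vector"
  assumes "smooth_on S f" "open S" "x \<in> S"
  shows "f differentiable (at x)"
proof -
  from assms(1) obtain D :: "nat \<Rightarrow> 'e \<Rightarrow> 'e list \<Rightarrow> 'f" where
    D: "(\<forall>x\<in>S. D 0 x [] = f x) \<and> (\<forall>n. \<forall>x\<in>S. bounded_multilinear n (D n x)) \<and>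
       (\<forall>n. \<forall>x\<in>S. \<forall>\<epsilon>>0. \<exists>\<delta>>0. \<forall>y\<in>S. norm (y - x) < \<delta> \<longrightarrow>
         (\<forall>vs. length vs = n \<longrightarrow>
            norm (D n y vs - D n x vs - D (Suc n) x ((y - x) # vs))
              \<le> \<epsilon> * norm (y - x) * prod_list (map norm vs)))"
    unfolding smooth_on_def by (elim exE)
  have D0: "D 0 y [] = f y" if "y \<in> S" for y using D that by simp
  from D \<open>x \<in> S\<close> have ml1: "bounded_multilinear 1 (D 1 x)" by simp
  from D \<open>x \<in> S\<close> have der: "\<forall>\<epsilon>>0. \<exists>\<delta>>0. \<forall>y\<in>S. norm (y - x) < \<delta> \<longrightarrow>
      (\<forall>vs. length vs = 0 \<longrightarrow> norm (D 0 y vs - D 0 x vs - D (Suc 0) x ((y - x) # vs))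
        \<le> \<epsilon> * norm (y - x) * prod_list (map norm vs))"
    by (elim conjE allE[where x="0::nat"] bspec)
  from ml1 have "\<And>us ws. length us + 1 + length ws = 1 \<Longrightarrow> linear (\<lambda>v. D 1 x (us @ v # ws))"
    unfolding bounded_multilinear_def by blast
  from this[of "[]" "[]"] have lin: "linear (\<lambda>v. D 1 x [v])" by simp
  obtain K where K: "\<And>vs. length vs = 1 \<Longrightarrow> norm (D 1 x vs) \<le> K * prod_list (map norm vs)"
    using ml1 unfolding bounded_multilinear_def by blast
  have bl: "bounded_linear (\<lambda>v. D 1 x [v])"
  proof (rule bounded_linear_intro)
    show "norm (D 1 x [v]) \<le> norm v * K" for v using K[of "[v]"] by (simp add: mult.commute)
  qed (rule linear_add[OF lin], rule linear_scale[OF lin])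
  have "(f has_derivative (\<lambda>v. D 1 x [v])) (at x within S)"
    unfolding has_derivative_within_alt
  proof (intro conjI allI impI bl)
    fix e :: real assume "e > 0"
    from der this obtain \<delta> where \<delta>: "\<delta> > 0"
      "\<And>y. y \<in> S \<Longrightarrow> norm (y - x) < \<delta> \<Longrightarrow>
        norm (D 0 y [] - D 0 x [] - D 1 x [y - x]) \<le> e * norm (y - x)"
      by force
    then show "\<exists>d>0. \<forall>y\<in>S. norm (y - x) < d \<longrightarrow>
        norm (f y - f x - D 1 x [y - x]) \<le> e * norm (y - x)"
      using D0 \<open>x \<in> S\<close> by (intro exI[of _ \<delta>]) simp
  qed
  then show ?thesis
    using assms(2,3) by (metis at_within_open differentiableI)
qed

lemma chart_inv_left:
  assumes "is_chart X c" "p \<in> fst c"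
  shows "chart_inv c (snd c p) = p"
proof -
  have "fst c \<subseteq> topspace X"
    using assms(1) openin_subset by (auto simp: is_chart_def)
  moreover have "inj_on (snd c) (topspace (subtopology X (fst c)))"
    using assms(1) homeomorphic_imp_injective_map unfolding is_chart_def by blast
  ultimately have "inj_on (snd c) (fst c)" by (simp add: Int_absorb1)
  then show ?thesis using assms(2) by (simp add: chart_inv_def)
qed

lemma open_chart_image:
  assumes "is_chart X c" "openin X V"
  shows "open (snd c ` (fst c \<inter> V))"
proof -
  have "open_map (subtopology X (fst c)) (top_of_set (snd c ` fst c)) (snd c)"
    using assms(1) homeomorphic_imp_open_map unfolding is_chart_def by blast
  moreover have "openin (subtopology X (fst c)) (fst c \<inter> V)"
    using assms(2) openin_subtopology_Int2 by blast
  ultimately have "openin (top_of_set (snd c ` fst c)) (snd c ` (fst c \<inter> V))"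
    unfolding open_map_def by blast
  then show ?thesis using assms(1) by (auto simp: is_chart_def openin_open_eq)
qed

section \<open>Transition maps and the identification of tangent spaces with the model space\<close>

locale smooth_atlas_structure =
  fixes X :: "'a topology" and A :: "('a, 'e::{real_inner, complete_space}) chart set"
  assumes atlas: "smooth_atlas X A"
begin

lemma chart: "c \<in> A \<Longrightarrow> is_chart X c"
  using atlas by (simp add: smooth_atlas_def)

lemma charts_at_nonempty:
  assumes "p \<in> topspace X"
  shows "\<exists>c. c \<in> charts_at A p"
proof -
  have "p \<in> (\<Union>c\<in>A. fst c)" using assms atlas by (simp add: smooth_atlas_def)
  then show ?thesis unfolding charts_at_def by blast
qed

lemma open_overlap:
  assumes "c \<in> A" "c' \<in> A"
  shows "open (snd c ` (fst c \<inter> fst c'))"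
  using open_chart_image chart assms unfolding is_chart_def by metis

lemma transition_has_derivative:
  assumes "c \<in> charts_at A p" "c' \<in> charts_at A p"
  shows "(transition c c' has_derivative frechet_derivative (transition c c') (at (snd c p)))
    (at (snd c p))"
proof -
  have "smooth_on (snd c ` (fst c \<inter> fst c')) (transition c c')"
    using atlas assms by (auto simp: smooth_atlas_def charts_at_def)
  then have "transition c c' differentiable (at (snd c p))"
    by (rule smooth_on_imp_differentiable) (use assms open_overlap in \<open>auto simp: charts_at_def\<close>)
  then show ?thesis by (simp add: frechet_derivative_works)
qed

lemma transition_chart:
  assumes "c \<in> A" "q \<in> fst c"
  shows "transition c c' (snd c q) = snd c' q"
  using chart_inv_left[OF chart] assms by (simp add: transition_def)

text \<open>The chain rule at \<open>snd c p\<close>, since composing two transitions gives the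
  third near that point.\<close>

lemma transition_cocycle:
  assumes "c \<in> charts_at A p" "c' \<in> charts_at A p" "c'' \<in> charts_at A p"
  shows "frechet_derivative (transition c' c'') (at (snd c' p))
      (frechet_derivative (transition c c') (at (snd c p)) w)
    = frechet_derivative (transition c c'') (at (snd c p)) w"
proof -
  let ?S = "snd c ` (fst c \<inter> fst c')"
  have c: "c \<in> A" "p \<in> fst c" "c' \<in> A" "p \<in> fst c'"
    using assms by (auto simp: charts_at_def)
  have "(transition c' c'' \<circ> transition c c' has_derivative
      frechet_derivative (transition c' c'') (at (snd c' p))
        \<circ> frechet_derivative (transition c c') (at (snd c p))) (at (snd c p))"
    using transition_has_derivative[OF assms(1,2)] transition_has_derivative[OF assms(2,3)]
      transition_chart[OF c(1,2), of c'] by (intro diff_chain_at) auto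
  then have "(transition c c'' has_derivative
      frechet_derivative (transition c' c'') (at (snd c' p))
        \<circ> frechet_derivative (transition c c') (at (snd c p))) (at (snd c p))"
  proof (rule has_derivative_transform_within_open)
    show "open ?S" by (rule open_overlap[OF c(1,3)])
    show "snd c p \<in> ?S" using c by blast
    \<comment> \<open>Both sides equal \<open>snd c'' q\<close> for the point \<open>q\<close> with
      coordinate \<open>y\<close>, even where \<open>q\<close> lies outside the domain of
      \<open>c''\<close>.\<close>
    show "(transition c' c'' \<circ> transition c c') y = transition c c'' y" if "y \<in> ?S" for y
      using that c by (auto simp: transition_chart)
  qed
  then show ?thesis
    using frechet_derivative_at by (metis comp_apply)
qed

lemma transition_derivative_self:
  assumes "c \<in> charts_at A p"
  shows "frechet_derivative (transition c c) (at (snd c p)) w = w"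
proof -
  have c: "c \<in> A" "p \<in> fst c" using assms by (auto simp: charts_at_def)
  have "((\<lambda>y. y) has_derivative (\<lambda>y. y)) (at (snd c p))" by simp
  then have "(transition c c has_derivative (\<lambda>y. y)) (at (snd c p))"
  proof (rule has_derivative_transform_within_open)
    show "open (snd c ` (fst c \<inter> fst c))" by (rule open_overlap[OF c(1,1)])
    show "snd c p \<in> snd c ` (fst c \<inter> fst c)" using c by blast
    show "y = transition c c y" if "y \<in> snd c ` (fst c \<inter> fst c)" for y
      using that c by (auto simp: transition_chart)
  qed
  then show ?thesis using frechet_derivative_at by metis
qed

text \<open>Transport \<open>w\<close> from \<open>c\<close> to every other chart at
  \<open>p\<close>; the cocycle rule makes the result compatible. Together with
  \<open>tangent_vector_eqI\<close> this makes evaluation at \<open>c\<close> a bijection from the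
  tangent space to the model space.\<close>

lemma tangent_vector_exists:
  assumes "c \<in> charts_at A p"
  shows "\<exists>v\<in>tangent_space A p. v c = w"
proof
  let ?v = "\<lambda>c'. if c' \<in> charts_at A p
    then frechet_derivative (transition c c') (at (snd c p)) w else 0"
  show "?v \<in> tangent_space A p"
    using transition_cocycle[OF assms] by (auto simp: tangent_space_def)
  show "?v c = w" using assms transition_derivative_self by simp
qed

lemma tangent_vector_eqI:
  assumes "c \<in> charts_at A p" "v \<in> tangent_space A p" "w \<in> tangent_space A p" "v c = w c"
  shows "v = w"
proof
  fix c'
  show "v c' = w c'"
  proof (cases "c' \<in> charts_at A p")
    case True
    have "x c' = frechet_derivative (transition c c') (at (snd c p)) (x c)"
      if "x \<in> tangent_space A p" for x
      using that assms(1) True unfolding tangent_space_def by blast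
    from this[OF assms(2)] this[OF assms(3)] assms(4) show ?thesis by (simp only:)
  next
    case False
    have "x c' = 0" if "x \<in> tangent_space A p" for x
      using that False unfolding tangent_space_def by blast
    from this[OF assms(2)] this[OF assms(3)] show ?thesis by (simp only:)
  qed
qed

section \<open>Gradients and descent directions\<close>

text \<open>Exposes the chart picked by \<open>SOME\<close> in \<open>differential\<close>. It
  depends on \<open>p\<close> alone, so one chart serves all functions and vectors at
  \<open>p\<close>.\<close>

lemma differential_in_chart:
  assumes "p \<in> topspace X"
  obtains c where "c \<in> charts_at A p"
    and "\<And>h v. differential A h p v
      = frechet_derivative (h \<circ> chart_inv c) (at (snd c p)) (v c)"
proof
  show "(SOME c. c \<in> charts_at A p) \<in> charts_at A p"
    using charts_at_nonempty[OF assms] by (rule someI_ex)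
qed (simp add: differential_def Let_def)

text \<open>In the chart \<open>c\<close> the metric becomes a bounded, symmetric, coercive form on
  the model space, which represents the differential by a unique vector. Lifting that vector to the
  tangent space shows that the definite description in \<open>gradient\<close> is proper.\<close>

lemma metric_gradient:
  assumes g: "riemannian_metric A g" and p: "p \<in> topspace X"
    and h: "differentiable_fun A h" and v: "v \<in> tangent_space A p"
  shows "g p (gradient A g h p) v = differential A h p v"
proof -
  obtain c where c: "c \<in> charts_at A p"
    and dh: "\<And>h v. differential A h p v
      = frechet_derivative (h \<circ> chart_inv c) (at (snd c p)) (v c)"
    using differential_in_chart[OF p] by blast
  have cA: "c \<in> A" "p \<in> fst c" using c by (auto simp: charts_at_def)
  let ?T = "tangent_space A p"
  from g cA obtain G :: "'e \<Rightarrow> 'e \<Rightarrow>\<^sub>L 'e \<Rightarrow>\<^sub>L real" where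
    G: "\<And>v w. v \<in> ?T \<Longrightarrow> w \<in> ?T \<Longrightarrow> g p v w = G (snd c p) (v c) (w c)"
    unfolding riemannian_metric_def by metis
  from g cA obtain C where C: "C > 0" "\<And>v. v \<in> ?T \<Longrightarrow> C * (norm (v c))\<^sup>2 \<le> g p v v"
    unfolding riemannian_metric_def by metis
  have sym: "g p v w = g p w v" if "v \<in> ?T" "w \<in> ?T" for v w
    using g cA that unfolding riemannian_metric_def by blast
  let ?b = "\<lambda>x y. G (snd c p) x y"
  let ?f = "frechet_derivative (h \<circ> chart_inv c) (at (snd c p))"
  have "bounded_bilinear ?b"
    by (rule bounded_bilinear.comp1[OF bounded_bilinear_blinfun_apply blinfun.bounded_linear_right])
  \<comment> \<open>Symmetry, like coercivity below, is assumed on tangent vectors only; it passes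
    to the model space because every model vector is a coordinate of a tangent vector.\<close>
  moreover have "?b x y = ?b y x" for x y
    using tangent_vector_exists[OF c, of x] tangent_vector_exists[OF c, of y] G sym by metis
  moreover have "C * (norm x)\<^sup>2 \<le> ?b x x" for x
    using tangent_vector_exists[OF c, of x] G C(2) by metis
  moreover have "bounded_linear ?f"
    using h cA by (auto simp: differentiable_fun_def frechet_derivative_works
        intro: has_derivative_bounded_linear)
  ultimately have ex1: "\<exists>!y. \<forall>w. ?b y w = ?f w"
    using C(1) by (intro coercive_representation) auto
  have "\<exists>!Y. Y \<in> ?T \<and> (\<forall>v\<in>?T. g p Y v = differential A h p v)"
  proof (rule ex_ex1I)
    from ex1 obtain y where y: "\<And>w. ?b y w = ?f w" by blast
    from tangent_vector_exists[OF c] obtain Y where "Y \<in> ?T" "Y c = y" by blast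
    then show "\<exists>Y. Y \<in> ?T \<and> (\<forall>v\<in>?T. g p Y v = differential A h p v)"
      using G y dh by (intro exI[of _ Y]) simp
  next
    have rep: "?b (Y c) w = ?f w"
      if "Y \<in> ?T \<and> (\<forall>v\<in>?T. g p Y v = differential A h p v)" for Y w
      using that tangent_vector_exists[OF c, of w] G dh by metis
    fix Y Z assume Y: "Y \<in> ?T \<and> (\<forall>v\<in>?T. g p Y v = differential A h p v)"
      and Z: "Z \<in> ?T \<and> (\<forall>v\<in>?T. g p Z v = differential A h p v)"
    then have "Y c = Z c" using ex1 rep by blast
    then show "Y = Z" using Y Z tangent_vector_eqI[OF c] by blast
  qed
  from theI'[OF this] v show ?thesis unfolding gradient_def by blast
qed

text \<open>Along the line \<open>\<gamma>\<close> in a chart each function has a negative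
  derivative at 0, hence decreases for all small positive \<open>t\<close>; finiteness of
  \<open>I\<close> gives one \<open>t\<close> for all of them.\<close>

lemma common_descent:
  assumes p: "p \<in> topspace X" and "finite I"
    and h: "\<And>i. i \<in> I \<Longrightarrow> differentiable_fun A (h i)"
    and neg: "\<And>i. i \<in> I \<Longrightarrow> differential A (h i) p v < 0"
  shows "\<exists>q\<in>topspace X. \<forall>i\<in>I. h i q < h i p"
proof -
  obtain c where c: "c \<in> charts_at A p"
    and dh: "\<And>h v. differential A h p v
      = frechet_derivative (h \<circ> chart_inv c) (at (snd c p)) (v c)"
    using differential_in_chart[OF p] by blast
  have cA: "c \<in> A" "p \<in> fst c" using c by (auto simp: charts_at_def)
  define \<gamma> where "\<gamma> t = snd c p + t *\<^sub>R v c" for t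
  have \<gamma>0: "\<gamma> 0 = snd c p" by (simp add: \<gamma>_def)
  have "\<forall>\<^sub>F t in at_right 0. h i (chart_inv c (\<gamma> t)) < h i p" if i: "i \<in> I" for i
  proof -
    let ?F = "h i \<circ> chart_inv c"
    have F: "(?F has_derivative frechet_derivative ?F (at (snd c p))) (at (\<gamma> 0))"
      using h[OF i] cA by (simp add: differentiable_fun_def frechet_derivative_works \<gamma>0)
    have "(\<gamma> has_derivative (\<lambda>t. t *\<^sub>R v c)) (at 0)"
      unfolding \<gamma>_def by (auto intro!: derivative_eq_intros)
    from diff_chain_at[OF this F]
    have "((?F \<circ> \<gamma>) has_derivative (\<lambda>t. t *\<^sub>R differential A (h i) p v)) (at 0)"
      using linear_scale[OF has_derivative_linear[OF F]] by (simp add: o_def dh)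
    then have "((?F \<circ> \<gamma>) has_real_derivative differential A (h i) p v) (at 0)"
      by (simp add: has_field_derivative_def mult_commute_abs)
    from DERIV_neg_dec_right[OF this neg[OF i]] obtain d
      where "d > 0" "\<And>t. 0 < t \<Longrightarrow> t < d \<Longrightarrow> (?F \<circ> \<gamma>) t < (?F \<circ> \<gamma>) 0" by auto
    then show ?thesis
      using chart_inv_left[OF chart[OF cA(1)] cA(2)]
      by (auto simp: eventually_at_right_field \<gamma>0)
  qed
  then have "\<forall>\<^sub>F t in at_right 0. \<forall>i\<in>I. h i (chart_inv c (\<gamma> t)) < h i p"
    using \<open>finite I\<close> by (intro eventually_ball_finite) auto
  \<comment> \<open>Only while the line stays in the chart image does \<open>chart_inv\<close>
    return a point of the chart domain, and so of the manifold.\<close>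
  moreover have "\<forall>\<^sub>F t in at_right 0. \<gamma> t \<in> snd c ` fst c"
  proof (rule topological_tendstoD)
    show "(\<gamma> \<longlongrightarrow> \<gamma> 0) (at_right 0)" unfolding \<gamma>_def by (intro tendsto_intros)
    show "open (snd c ` fst c)" using chart[OF cA(1)] by (simp add: is_chart_def)
    show "\<gamma> 0 \<in> snd c ` fst c" using cA by (simp add: \<gamma>0)
  qed
  ultimately have "\<forall>\<^sub>F t in at_right 0.
      (\<forall>i\<in>I. h i (chart_inv c (\<gamma> t)) < h i p) \<and> \<gamma> t \<in> snd c ` fst c"
    by (rule eventually_conj)
  then obtain t where t: "\<forall>i\<in>I. h i (chart_inv c (\<gamma> t)) < h i p" "\<gamma> t \<in> snd c ` fst c"
    using eventually_happens'[OF trivial_limit_at_right_real] by blast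
  moreover have "chart_inv c (\<gamma> t) \<in> fst c"
    using t(2) unfolding chart_inv_def by (rule inv_into_into)
  moreover have "fst c \<subseteq> topspace X"
    using chart[OF cA(1)] openin_subset by (auto simp: is_chart_def)
  ultimately show ?thesis by blast
qed

end

section \<open>From the inequality problem to strict minimality and back\<close>

text \<open>\<open>sqrt\<close> is negative at negative reals, so the lower bound in the metric is
  called upon.\<close>

lemma metric_norm_nonneg:
  assumes "riemannian_metric A g" "c \<in> charts_at A p" "v \<in> tangent_space A p"
  shows "metric_norm g p v \<ge> 0"
proof -
  obtain C where "C > 0" "C * (norm (v c))\<^sup>2 \<le> g p v v"
    using assms unfolding riemannian_metric_def charts_at_def by blast
  then have "0 \<le> g p v v"
    by (meson less_imp_le mult_nonneg_nonneg order_trans zero_le_power2)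
  then show ?thesis by (simp add: metric_norm_def)
qed

theorem theorem8:
  fixes X :: "'a topology"
    and A :: "('a, 'e::{real_inner, complete_space}) chart set"
    and g :: "'a \<Rightarrow> ('a, 'e) tvec \<Rightarrow> ('a, 'e) tvec \<Rightarrow> real"
    and \<eta> :: "'a \<Rightarrow> 'a \<Rightarrow> ('a, 'e) tvec"
    and h :: "nat \<Rightarrow> 'a \<Rightarrow> real"
    and m k :: nat and u' :: 'a
  assumes "riemannian_manifold X A g"
    and "\<And>u v. u \<in> topspace X \<Longrightarrow> v \<in> topspace X \<Longrightarrow> \<eta> u v \<in> tangent_space A v"
    and "m \<ge> 1" and "k \<ge> 1"
    and "\<And>i. i \<in> {1..k} \<Longrightarrow> differentiable_fun A (h i)"
    and "\<And>i. i \<in> {1..k} \<Longrightarrow> strongly_invex X A g \<eta> m (h i)"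
    and "u' \<in> topspace X"
  shows "VVLIP_solution X A g \<eta> k h u' \<longleftrightarrow> strict_minimizer X g \<eta> m k h u'"
proof -
  have g: "riemannian_metric A g" and "smooth_atlas X A"
    using assms(1) by (auto simp: riemannian_manifold_def smooth_manifold_def)
  then interpret smooth_atlas_structure X A by unfold_locales
  obtain c where c: "c \<in> charts_at A u'" using charts_at_nonempty[OF assms(7)] by blast
  have \<eta>: "\<eta> u u' \<in> tangent_space A u'" if "u \<in> topspace X" for u
    using assms(2,7) that by blast
  have norm_nonneg: "metric_norm g u' (\<eta> u u') ^ m \<ge> 0" if "u \<in> topspace X" for u
    using metric_norm_nonneg[OF g c \<eta>[OF that]] by simp
  have "VVLIP_solution X A g \<eta> k h u' \<longleftrightarrow> (\<forall>u\<in>topspace X.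
      \<not> vec_less k (\<lambda>i. g u' (gradient A g (h i) u') (\<eta> u u')) (\<lambda>i. 0))"
    using assms(7) by (simp add: VVLIP_solution_def)
  \<comment> \<open>Gradients turn into differentials, the form in which invexity and descent are
    stated.\<close>
  also have "\<dots> \<longleftrightarrow> (\<forall>u\<in>topspace X. \<exists>i\<in>{1..k}. differential A (h i) u' (\<eta> u u') \<ge> 0)"
    using metric_gradient[OF g assms(7) assms(5) \<eta>]
    by (simp add: vec_less_def not_less cong: ball_cong_simp bex_cong_simp)
  finally have vvlip: "VVLIP_solution X A g \<eta> k h u' \<longleftrightarrow>
      (\<forall>u\<in>topspace X. \<exists>i\<in>{1..k}. differential A (h i) u' (\<eta> u u') \<ge> 0)" .
  show ?thesis
  proof
    assume "VVLIP_solution X A g \<eta> k h u'"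
    have "\<forall>i\<in>{1..k}. \<exists>\<delta>>0. \<forall>u\<in>topspace X. h i u \<ge>
        h i u' + differential A (h i) u' (\<eta> u u') + \<delta> * metric_norm g u' (\<eta> u u') ^ m"
      using assms(6,7) unfolding strongly_invex_def by blast
    then obtain \<delta> where \<delta>: "\<And>i. i \<in> {1..k} \<Longrightarrow> \<delta> i > 0"
      and invex: "\<And>i u. i \<in> {1..k} \<Longrightarrow> u \<in> topspace X \<Longrightarrow> h i u \<ge>
        h i u' + differential A (h i) u' (\<eta> u u') + \<delta> i * metric_norm g u' (\<eta> u u') ^ m"
      by metis
    \<comment> \<open>The index with nonnegative differential varies with \<open>u\<close>, so the
      constant must work for all indices; \<open>k \<ge> 1\<close> makes the minimum one over a
      nonempty set.\<close>
    define d where "d = Min (\<delta> ` {1..k})"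
    have "d > 0" using \<delta> assms(4) by (simp add: d_def)
    moreover have "\<not> vec_less k (\<lambda>i. h i u)
        (\<lambda>i. h i u' + d * metric_norm g u' (\<eta> u u') ^ m)" if u: "u \<in> topspace X" for u
    proof -
      obtain i where i: "i \<in> {1..k}" "differential A (h i) u' (\<eta> u u') \<ge> 0"
        using vvlip \<open>VVLIP_solution X A g \<eta> k h u'\<close> u by blast
      have "d \<le> \<delta> i" using i(1) by (simp add: d_def)
      then have "d * metric_norm g u' (\<eta> u u') ^ m \<le> \<delta> i * metric_norm g u' (\<eta> u u') ^ m"
        using norm_nonneg[OF u] by (rule mult_right_mono)
      then have "h i u \<ge> h i u' + d * metric_norm g u' (\<eta> u u') ^ m"
        using invex[OF i(1) u] i(2) by linarith
      then show ?thesis using i(1) unfolding vec_less_def by (meson not_less)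
    qed
    ultimately show "strict_minimizer X g \<eta> m k h u'"
      using assms(7) unfolding strict_minimizer_def by blast
  next
    assume "strict_minimizer X g \<eta> m k h u'"
    then obtain \<delta> where \<delta>: "\<delta> > 0" "\<And>u. u \<in> topspace X \<Longrightarrow> \<not> vec_less k (\<lambda>i. h i u)
        (\<lambda>i. h i u' + \<delta> * metric_norm g u' (\<eta> u u') ^ m)"
      unfolding strict_minimizer_def by blast
    show "VVLIP_solution X A g \<eta> k h u'"
      unfolding vvlip
    proof (rule ccontr)
      assume "\<not> (\<forall>u\<in>topspace X. \<exists>i\<in>{1..k}. differential A (h i) u' (\<eta> u u') \<ge> 0)"
      then obtain u where "\<And>i. i \<in> {1..k} \<Longrightarrow> differential A (h i) u' (\<eta> u u') < 0"
        by (meson not_le)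
      with assms(5,7) obtain q where q: "q \<in> topspace X" "\<forall>i\<in>{1..k}. h i q < h i u'"
        using common_descent[of u' "{1..k}" h "\<eta> u u'"] by auto
      \<comment> \<open>Adding this term only weakens the strict decrease at \<open>q\<close>, so
        \<open>q\<close> violates strict minimality.\<close>
      moreover have "\<delta> * metric_norm g u' (\<eta> q u') ^ m \<ge> 0"
        using \<delta>(1) norm_nonneg[OF q(1)] by simp
      ultimately show False
        using \<delta>(2)[OF q(1)] by (auto simp: vec_less_def intro: add_strict_increasing2)
    qed
  qed
qed

end
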